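(* Let $p$ be a prime, $m\in\mathbb{N}$ with $m\ge 1$, $n=p^m$, and $S=\{a\in\mathbb{Z}_n \mid \gcd(a,n)=1\}$. Then the Cayley graph $\Gamma=\mathrm{Cay}(\mathbb{Z}_n,S)$ is an integral graph.
   Context: For a finite group $G$ and an inverse-closed subset $H\subseteq G$ not containing the identity, $\mathrm{Cay}(G,H)$ is the simple undirected graph with vertex set $G$ in which $x,y$ are adjacent iff $x^{-1}y\in H$. Here $G=\mathbb{Z}_n$ is the additive cyclic group, so $x,y$ are adjacent iff $y-x\in S$. A graph is integral if all eigenvalues of its adjacency matrix are integers. *)

theory Defs
  imports
    "HOL-Algebra.Elementary_Groups"
    "HOL-Computational_Algebra.Primes"
    "Graph_Theory.Pair_Digraph"
    "Jordan_Normal_Form.Char_Poly"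
begin

text \<open>
  As in \<^theory>\<open>Graph_Theory.Pair_Digraph\<close>, a simple undirected graph is a finite, loop-free,
  symmetric digraph whose arcs are pairs of vertices (locale \<^locale>\<open>pair_graph\<close>).
\<close>

definition cayley_graph :: "('a, 'b) monoid_scheme \<Rightarrow> 'a set \<Rightarrow> 'a pair_pre_digraph" where
  "cayley_graph G H =
     \<lparr> pverts = carrier G,
       parcs = {(x, y). x \<in> carrier G \<and> y \<in> carrier G \<and> inv\<^bsub>G\<^esub> x \<otimes>\<^bsub>G\<^esub> y \<in> H} \<rparr>"

lemma pair_graph_cayley_graph:
  fixes G (structure)
  assumes "group G" "finite (carrier G)" "H \<subseteq> carrier G"
    and "\<one> \<notin> H" "\<And>h. h \<in> H \<Longrightarrow> inv h \<in> H"
  shows "pair_graph (cayley_graph G H)"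
proof -
  interpret group G by fact
  have sym: "inv y \<otimes> x \<in> H" if "x \<in> carrier G" "y \<in> carrier G" "inv x \<otimes> y \<in> H" for x y
    using assms(5)[OF that(3)] that by (simp add: inv_mult_group)
  have "finite (parcs (cayley_graph G H))"
    by (rule finite_subset[of _ "carrier G \<times> carrier G"])
      (auto simp: cayley_graph_def assms(2))
  then show ?thesis
    using assms sym
    by unfold_locales
      (auto simp: cayley_graph_def symmetric_def arcs_ends_def arc_to_ends_def intro!: symI)
qed

text \<open>
  The rows and columns of the adjacency matrix are indexed along an enumeration \<open>vs\<close> of the
  vertices. The entries are complex so that all eigenvalues are taken into account.
\<close>

definition adjacency_matrix :: "'a pair_pre_digraph \<Rightarrow> 'a list \<Rightarrow> complex mat" where
  "adjacency_matrix \<Gamma> vs =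
     mat (length vs) (length vs) (\<lambda>(i, j). if (vs ! i, vs ! j) \<in> parcs \<Gamma> then 1 else 0)"

definition integral_graph :: "'a pair_pre_digraph \<Rightarrow> bool" where
  "integral_graph \<Gamma> \<longleftrightarrow>
     finite (pverts \<Gamma>) \<and>
     (\<forall>vs. distinct vs \<and> set vs = pverts \<Gamma> \<longrightarrow>
        (\<forall>k. eigenvalue (adjacency_matrix \<Gamma> vs) k \<longrightarrow> k \<in> \<int>))"

text \<open>
  The connection set of the unitary Cayley graph on \<open>\<int>\<^sub>n\<close> is admissible.
\<close>

lemma pair_graph_unitary_cayley_graph:
  assumes "n \<ge> 2"
  shows "pair_graph (cayley_graph (integer_mod_group n)
           {a \<in> carrier (integer_mod_group n). gcd a (int n) = 1})"
proof (rule pair_graph_cayley_graph)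
  fix h assume h: "h \<in> {a \<in> carrier (integer_mod_group n). gcd a (int n) = 1}"
  have "inv\<^bsub>integer_mod_group n\<^esub> h = (- h) mod int n"
    using h by simp
  moreover have "gcd ((- h) mod int n) (int n) = 1"
    using h by (simp add: gcd.commute[of _ "int n"] gcd_red_int[symmetric])
  ultimately show "inv\<^bsub>integer_mod_group n\<^esub> h \<in>
      {a \<in> carrier (integer_mod_group n). gcd a (int n) = 1}"
    using assms by (simp add: carrier_integer_mod_group)
qed (use assms in \<open>auto simp: carrier_integer_mod_group\<close>)

end

theory Submission
  imports Defs
begin

text \<open>
  Since \<open>n\<close> is a power of \<open>p\<close>, two vertices are adjacent iff they differ modulo \<open>p\<close>, so the graph
  is complete multipartite with parts of equal size \<open>q = n / p\<close>. Let \<open>f\<close> be an eigenvector for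
  \<open>k\<close> and \<open>T\<close> its total sum. Then \<open>k * f x\<close> is \<open>T\<close> minus the sum of \<open>f\<close> over the part of \<open>x\<close>.
  If \<open>k \<noteq> 0\<close>, then \<open>f\<close> is constant on parts, whence \<open>(k + q) * f x = T\<close>; summing over all
  vertices gives \<open>(k + q) * T = n * T\<close>. Hence \<open>k\<close> is \<open>0\<close>, \<open>-q\<close> or \<open>n - q\<close>.
\<close>

text \<open>Reading the coordinates of an eigenvector as values at the vertices removes the
  enumeration \<open>vs\<close> from the rest of the argument: row \<open>x\<close> of the
  eigenvalue equation becomes a sum over the neighbours of \<open>x\<close>.\<close>

lemma eigenvalue_adjacency_matrixE:
  assumes "eigenvalue (adjacency_matrix \<Gamma> vs) k" and "distinct vs"
  obtains f where "\<exists>x\<in>set vs. f x \<noteq> 0"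
    and "\<And>x. x \<in> set vs \<Longrightarrow> k * f x = (\<Sum>y | y \<in> set vs \<and> (x, y) \<in> parcs \<Gamma>. f y)"
proof -
  let ?n = "length vs"
  let ?A = "adjacency_matrix \<Gamma> vs"
  obtain v where v: "v \<in> carrier_vec ?n" "v \<noteq> 0\<^sub>v ?n" and Av: "?A *\<^sub>v v = k \<cdot>\<^sub>v v"
    using assms(1) by (auto simp: eigenvalue_def eigenvector_def adjacency_matrix_def)
  \<comment> \<open>Each vertex occurs exactly once in \<open>vs\<close>, so its position determines
    which coordinate of \<open>v\<close> it receives.\<close>
  define f where "f x = v $ (inv_into {..<?n} ((!) vs) x)" for x
  have bij: "bij_betw ((!) vs) {..<?n} (set vs)"
    using assms(2) by (rule bij_betw_nth) auto
  have f_nth: "f (vs ! i) = v $ i" if "i < ?n" for i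
    using that bij by (simp add: f_def bij_betw_def)
  have "\<exists>x\<in>set vs. f x \<noteq> 0"
  proof (rule ccontr)
    assume "\<not> ?thesis"
    then have "v $ i = 0" if "i < ?n" for i
      using that f_nth[OF that] nth_mem[OF that] by auto
    then have "v = 0\<^sub>v ?n"
      using v(1) by (intro eq_vecI) auto
    with v(2) show False by simp
  qed
  moreover have "k * f x = (\<Sum>y | y \<in> set vs \<and> (x, y) \<in> parcs \<Gamma>. f y)" if x: "x \<in> set vs" for x
  proof -
    obtain i where i: "i < ?n" "x = vs ! i"
      using x by (auto simp: in_set_conv_nth)
    have "k * f x = (?A *\<^sub>v v) $ i"
      using i v(1) by (simp add: Av f_nth)
    also have "\<dots> = (\<Sum>j<?n. if (x, vs ! j) \<in> parcs \<Gamma> then f (vs ! j) else 0)"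
      using i v(1)
      by (auto simp: adjacency_matrix_def scalar_prod_def f_nth atLeast0LessThan intro!: sum.cong)
    also have "\<dots> = (\<Sum>y\<in>set vs. if (x, y) \<in> parcs \<Gamma> then f y else 0)"
      by (rule sum.reindex_bij_betw[OF bij])
    also have "\<dots> = (\<Sum>y | y \<in> set vs \<and> (x, y) \<in> parcs \<Gamma>. f y)"
      by (rule sum.inter_filter[symmetric]) simp
    finally show ?thesis .
  qed
  ultimately show thesis by (rule that)
qed

text \<open>The values of \<open>c\<close> label the parts. An integral domain allows cancelling
  \<open>k\<close>, a nonzero value of \<open>f\<close>, and \<open>T\<close>.\<close>

lemma complete_multipartite_eigenvalue:
  fixes f :: "'a \<Rightarrow> 'b::idom" and c :: "'a \<Rightarrow> 'c" and q :: nat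
  assumes fin: "finite V"
    and part: "\<And>x. x \<in> V \<Longrightarrow> card {y \<in> V. c y = c x} = q"
    and nz: "\<exists>x\<in>V. f x \<noteq> 0"
    and eig: "\<And>x. x \<in> V \<Longrightarrow> k * f x = (\<Sum>y | y \<in> V \<and> c y \<noteq> c x. f y)"
  shows "k = 0 \<or> k = - of_nat q \<or> k = of_nat (card V) - of_nat q"
proof (cases "k = 0")
  case False
  define T where "T = (\<Sum>y\<in>V. f y)"
  have split: "T = (\<Sum>y | y \<in> V \<and> c y = c x. f y) + k * f x" if "x \<in> V" for x
  proof -
    have "V = {y \<in> V. c y = c x} \<union> {y \<in> V. c y \<noteq> c x}" by auto
    then have "T = (\<Sum>y\<in>{y \<in> V. c y = c x} \<union> {y \<in> V. c y \<noteq> c x}. f y)"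
      by (simp add: T_def)
    also have "\<dots> = (\<Sum>y | y \<in> V \<and> c y = c x. f y) + (\<Sum>y | y \<in> V \<and> c y \<noteq> c x. f y)"
      using fin by (intro sum.union_disjoint) auto
    finally show ?thesis by (simp add: eig[OF that])
  qed
  have const: "f y = f x" if "x \<in> V" "y \<in> V" "c y = c x" for x y
  proof -
    \<comment> \<open>Vertices in the same part have the same neighbours, so both sides are the same
      sum.\<close>
    have "k * f y = k * f x"
      by (simp add: eig that)
    with False show ?thesis by simp
  qed
  have fT: "(k + of_nat q) * f x = T" if "x \<in> V" for x
  proof -
    have "(\<Sum>y | y \<in> V \<and> c y = c x. f y) = (\<Sum>y | y \<in> V \<and> c y = c x. f x)"
      using const[OF that] by (intro sum.cong) auto
    also have "\<dots> = of_nat q * f x"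
      by (simp add: part[OF that])
    finally show ?thesis
      using split[OF that] by (simp add: algebra_simps)
  qed
  have "(k + of_nat q) * T = (\<Sum>x\<in>V. (k + of_nat q) * f x)"
    by (simp add: T_def sum_distrib_left)
  also have "\<dots> = of_nat (card V) * T"
    by (simp add: fT)
  finally have "T = 0 \<or> k + of_nat q = of_nat (card V)"
    by auto
  then show ?thesis
  proof
    assume "T = 0"
    \<comment> \<open>Apply \<open>fT\<close> at a vertex where \<open>f\<close> does not vanish and
      cancel that value.\<close>
    then have "k + of_nat q = 0"
      using nz fT by auto
    then show ?thesis by (simp add: eq_neg_iff_add_eq_0)
  qed (simp add: eq_diff_eq)
qed simp

text \<open>The class consists of the numbers \<open>p * k + r\<close> with 0 \<le> k < q, and
  division by \<open>p\<close> recovers \<open>k\<close>.\<close>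

lemma card_residue_class_int:
  fixes p q :: nat and r :: int
  assumes "0 \<le> r" "r < int p"
  shows "card {y \<in> {0..<int (p * q)}. y mod int p = r} = q"
proof -
  have p: "int p > 0" using assms by simp
  have "bij_betw (\<lambda>k. int p * k + r) {0..<int q} {y \<in> {0..<int (p * q)}. y mod int p = r}"
  proof (rule bij_betw_byWitness[where f' = "\<lambda>y. y div int p"])
    show "(\<lambda>k. int p * k + r) ` {0..<int q} \<subseteq> {y \<in> {0..<int (p * q)}. y mod int p = r}"
    proof clarify
      fix k assume k: "k \<in> {0..<int q}"
      \<comment> \<open>Using \<open>k + 1\<close> instead of \<open>k\<close> leaves a slack of
        \<open>p\<close>, which absorbs \<open>r < p\<close>.\<close>
      then have "int p * (k + 1) \<le> int p * int q"
        by (intro mult_left_mono) auto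
      then have "int p * k + r < int (p * q)"
        using assms by (simp add: algebra_simps)
      then show "int p * k + r \<in> {0..<int (p * q)} \<and> (int p * k + r) mod int p = r"
        using k assms by simp
    qed
    show "(\<lambda>y. y div int p) ` {y \<in> {0..<int (p * q)}. y mod int p = r} \<subseteq> {0..<int q}"
    proof clarify
      fix y assume y: "y \<in> {0..<int (p * q)}"
      have "int p * (y div int p) \<le> y"
        using mult_div_mod_eq[of "int p" y] pos_mod_sign[OF p, of y] by linarith
      also have "y < int p * int q"
        using y by simp
      finally show "y div int p \<in> {0..<int q}"
        using p y by (simp add: pos_imp_zdiv_nonneg_iff)
    qed
  qed (use assms in auto)
  then show ?thesis
    by (simp add: bij_betw_same_card[symmetric])
qed

text \<open>For positive \<open>m\<close>, being coprime to \<open>p ^ m\<close> amounts to being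
  coprime to \<open>p\<close>, which for a prime means not being divisible by it. With
  \<open>m = 0\<close> every integer would be coprime to the modulus.\<close>

lemma coprime_diff_prime_power_iff:
  fixes p m :: nat and x y :: int
  assumes "prime p" and "m \<ge> 1"
  shows "coprime (y - x) (int (p ^ m)) \<longleftrightarrow> y mod int p \<noteq> x mod int p"
proof -
  have "prime (int p)" using assms(1) by simp
  then have "coprime (y - x) (int p) \<longleftrightarrow> \<not> int p dvd y - x"
    by (metis coprime_commute prime_imp_coprime coprime_absorb_left not_prime_unit)
  then show ?thesis
    using assms(2) by (simp add: mod_eq_dvd_iff)
qed

theorem proposition3p2:
  fixes p m n :: nat and S :: "int set"
  assumes "prime p" and "m \<ge> 1" and "n = p ^ m"
    and "S = {a \<in> carrier (integer_mod_group n). gcd a (int n) = 1}"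
  shows "integral_graph (cayley_graph (integer_mod_group n) S)"
proof -
  let ?\<Gamma> = "cayley_graph (integer_mod_group n) S"
  \<comment> \<open>This is the size of each residue class modulo \<open>p\<close> within
    \<open>{0..<int n}\<close>.\<close>
  define q where "q = p ^ (m - 1)"
  have n: "n = p * q"
    using assms(2,3) by (simp add: q_def power_eq_if)
  have p: "p > 0" using assms(1) by (rule prime_gt_0_nat)
  then have n0: "n > 0" using assms(3) by simp
  have V: "pverts ?\<Gamma> = {0..<int n}"
    using n0 by (simp add: cayley_graph_def carrier_integer_mod_group)
  have arcs: "(x, y) \<in> parcs ?\<Gamma> \<longleftrightarrow> y mod int p \<noteq> x mod int p"
    if "x \<in> {0..<int n}" "y \<in> {0..<int n}" for x y
  proof -
    have "inv\<^bsub>integer_mod_group n\<^esub> x \<otimes>\<^bsub>integer_mod_group n\<^esub> y = (y - x) mod int n"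
      using that n0 by (simp add: carrier_integer_mod_group mod_simps)
    then have "(x, y) \<in> parcs ?\<Gamma> \<longleftrightarrow> gcd ((y - x) mod int n) (int n) = 1"
      using that n0
      by (simp add: cayley_graph_def assms(4) carrier_integer_mod_group
          del: inv_integer_mod_group mult_integer_mod_group)
    \<comment> \<open>Reduction modulo \<open>n\<close> preserves the gcd with
      \<open>n\<close>.\<close>
    also have "\<dots> \<longleftrightarrow> coprime (y - x) (int n)"
      by (simp add: coprime_iff_gcd_eq_1 gcd.commute[of _ "int n"] gcd_red_int[symmetric])
    finally show ?thesis
      using coprime_diff_prime_power_iff[OF assms(1,2)] assms(3) by simp
  qed
  have "k \<in> \<int>" if vs: "distinct vs" "set vs = pverts ?\<Gamma>"
    and k: "eigenvalue (adjacency_matrix ?\<Gamma> vs) k" for vs k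
  proof -
    obtain f where f: "\<exists>x\<in>{0..<int n}. f x \<noteq> 0"
      and eig: "\<And>x. x \<in> {0..<int n} \<Longrightarrow>
        k * f x = (\<Sum>y | y \<in> {0..<int n} \<and> (x, y) \<in> parcs ?\<Gamma>. f y)"
      using eigenvalue_adjacency_matrixE[OF k vs(1)] unfolding vs(2) V by blast
    have "k = 0 \<or> k = - of_nat q \<or> k = of_nat (card {0..<int n}) - of_nat q"
    proof (rule complete_multipartite_eigenvalue[where c = "\<lambda>x. x mod int p" and f = f])
      show "card {y \<in> {0..<int n}. y mod int p = x mod int p} = q" for x
        unfolding n by (rule card_residue_class_int) (use p in auto)
      show "k * f x = (\<Sum>y | y \<in> {0..<int n} \<and> y mod int p \<noteq> x mod int p. f y)"
        if "x \<in> {0..<int n}" for x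
        unfolding eig[OF that] using arcs[OF that] by (intro sum.cong) auto
    qed (use f in auto)
    then show ?thesis by auto
  qed
  then show ?thesis
    by (auto simp: integral_graph_def V)
qed

end
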